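(* Let $K$ be a definably complete expansion of an ordered field, let $m,n\ge 1$, and let $D\subseteq K^{m+n}$ be a (not necessarily definable) subset. For $x\in K^m$ put $D_x:=\{y\in K^n : (x,y)\in D\}$, and let $T:=\{x\in K^m : D_x \text{ is definably meager in } K^n\}$. If $D$ is definably meager in $K^{m+n}$, then $T$ is definably residual in $K^m$.
   Context: "Definable" means definable in the first-order structure $K$ with parameters from $K$. $K$ carries the order topology, $K^n$ the product topology. An expansion $K$ of an ordered field is definably complete if every definable subset of $K$ has a supremum in $K\cup\{\pm\infty\}$. Let $X\subseteq Y\subseteq K^n$ with $Y$ definable. $X$ is nowhere dense in $Y$ if the closure of $X$ in $Y$ has empty interior in $Y$. $X$ is definably meager in $Y$ if there is a definable family $(A(t))_{t\in K}$ of nowhere dense subsets of $Y$, increasing in $t$ (i.e. $A(t)\subseteq A(t')$ for $t\le t'$), with $X\subseteq\bigcup_{t\in K}A(t)$ ($X$ itself need not be definable). $X$ is definably residual in $Y$ if $Y\setminus X$ is definably meager in $Y$. *)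

theory Defs
  imports "HOL-Analysis.Analysis" "HOL-Library.Extended" "HOL-Library.Lub_Glb"
begin

(* The language consists of the symbols 0, 1, +, -, *, < of ordered fields, which always have
   their standard interpretation in 'a, and of further function symbols 'f and relation
   symbols 'r, whose arities and interpretations are recorded in an expansion of the ordered
   field 'a. An interpretation is only ever applied to lists of the length given by the arity. *)

record ('a, 'f, 'r) expansion =
  fun_arity :: "'f \<Rightarrow> nat"
  rel_arity :: "'r \<Rightarrow> nat"
  fun_interp :: "'f \<Rightarrow> 'a list \<Rightarrow> 'a"
  rel_interp :: "'r \<Rightarrow> 'a list \<Rightarrow> bool"

datatype 'f trm =
    TVar nat
  | TZero
  | TOne
  | TNeg "'f trm"
  | TAdd "'f trm" "'f trm"
  | TMul "'f trm" "'f trm"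
  | TFun 'f "'f trm list"

datatype ('f, 'r) fml =
    FEq "'f trm" "'f trm"
  | FLess "'f trm" "'f trm"
  | FRel 'r "'f trm list"
  | FNot "('f, 'r) fml"
  | FAnd "('f, 'r) fml" "('f, 'r) fml"
  | FEx nat "('f, 'r) fml"

primrec wf_trm :: "('a, 'f, 'r) expansion \<Rightarrow> 'f trm \<Rightarrow> bool" where
  "wf_trm K (TVar i) = True"
| "wf_trm K TZero = True"
| "wf_trm K TOne = True"
| "wf_trm K (TNeg s) = wf_trm K s"
| "wf_trm K (TAdd s t) = (wf_trm K s \<and> wf_trm K t)"
| "wf_trm K (TMul s t) = (wf_trm K s \<and> wf_trm K t)"
| "wf_trm K (TFun f ts) = (length ts = fun_arity K f \<and> list_all id (map (wf_trm K) ts))"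

primrec wf_fml :: "('a, 'f, 'r) expansion \<Rightarrow> ('f, 'r) fml \<Rightarrow> bool" where
  "wf_fml K (FEq s t) = (wf_trm K s \<and> wf_trm K t)"
| "wf_fml K (FLess s t) = (wf_trm K s \<and> wf_trm K t)"
| "wf_fml K (FRel r ts) = (length ts = rel_arity K r \<and> list_all (wf_trm K) ts)"
| "wf_fml K (FNot p) = wf_fml K p"
| "wf_fml K (FAnd p q) = (wf_fml K p \<and> wf_fml K q)"
| "wf_fml K (FEx i p) = wf_fml K p"

primrec trm_val ::
  "('a::linordered_field, 'f, 'r) expansion \<Rightarrow> (nat \<Rightarrow> 'a) \<Rightarrow> 'f trm \<Rightarrow> 'a" where
  "trm_val K e (TVar i) = e i"
| "trm_val K e TZero = 0"
| "trm_val K e TOne = 1"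
| "trm_val K e (TNeg s) = - trm_val K e s"
| "trm_val K e (TAdd s t) = trm_val K e s + trm_val K e t"
| "trm_val K e (TMul s t) = trm_val K e s * trm_val K e t"
| "trm_val K e (TFun f ts) = fun_interp K f (map (trm_val K e) ts)"

primrec sat ::
  "('a::linordered_field, 'f, 'r) expansion \<Rightarrow> (nat \<Rightarrow> 'a) \<Rightarrow> ('f, 'r) fml \<Rightarrow> bool" where
  "sat K e (FEq s t) = (trm_val K e s = trm_val K e t)"
| "sat K e (FLess s t) = (trm_val K e s < trm_val K e t)"
| "sat K e (FRel r ts) = rel_interp K r (map (trm_val K e) ts)"
| "sat K e (FNot p) = (\<not> sat K e p)"
| "sat K e (FAnd p q) = (sat K e p \<and> sat K e q)"
| "sat K e (FEx i p) = (\<exists>a. sat K (e(i := a)) p)"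

(* K^n consists of the functions that are undefined outside {..<n}. *)

definition pow_space :: "nat \<Rightarrow> (nat \<Rightarrow> 'a) set" where
  "pow_space n = ({..<n} \<rightarrow>\<^sub>E UNIV)"

(* In the class linorder_topology, euclidean is the order topology. *)

definition pow_top :: "nat \<Rightarrow> (nat \<Rightarrow> 'a::linorder_topology) topology" where
  "pow_top n = product_topology (\<lambda>_. euclidean) {..<n}"

(* Concatenation: for x in K^m and y in K^n this is the point (x,y) of K^(m+n).
   The values of x from m onwards are ignored. *)

definition join :: "nat \<Rightarrow> (nat \<Rightarrow> 'a) \<Rightarrow> (nat \<Rightarrow> 'a) \<Rightarrow> nat \<Rightarrow> 'a" where
  "join m x y = (\<lambda>i. if i < m then x i else y (i - m))"

definition section_at :: "nat \<Rightarrow> nat \<Rightarrow> (nat \<Rightarrow> 'a) set \<Rightarrow> (nat \<Rightarrow> 'a) \<Rightarrow> (nat \<Rightarrow> 'a) set" where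
  "section_at m n D x = {y \<in> pow_space n. join m x y \<in> D}"

(* The variables of p from n onwards are the parameters; only finitely many of the values c
   occur, as p is a finite expression. *)

definition definable ::
  "('a::linordered_field, 'f, 'r) expansion \<Rightarrow> nat \<Rightarrow> (nat \<Rightarrow> 'a) set \<Rightarrow> bool" where
  "definable K n X \<longleftrightarrow>
     (\<exists>p c. wf_fml K p \<and> X = {x \<in> pow_space n. sat K (join n x c) p})"

definition definably_complete :: "('a::linordered_field, 'f, 'r) expansion \<Rightarrow> bool" where
  "definably_complete K \<longleftrightarrow>
     (\<forall>S. definable K 1 {x \<in> pow_space 1. x 0 \<in> S} \<longrightarrow>
        (\<exists>s :: 'a extended. isLub UNIV (Fin ` S) s))"

definition nowhere_dense_in ::
  "nat \<Rightarrow> (nat \<Rightarrow> 'a::linorder_topology) set \<Rightarrow> (nat \<Rightarrow> 'a) set \<Rightarrow> bool" where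
  "nowhere_dense_in n Y X \<longleftrightarrow> X \<subseteq> Y \<and>
     subtopology (pow_top n) Y interior_of (subtopology (pow_top n) Y closure_of X) = {}"

(* The total set of the family, consisting of the (t,y) with y in A t, is definable. *)

definition definable_family ::
  "('a::linordered_field, 'f, 'r) expansion \<Rightarrow> nat \<Rightarrow> ('a \<Rightarrow> (nat \<Rightarrow> 'a) set) \<Rightarrow> bool" where
  "definable_family K n A \<longleftrightarrow> (\<forall>t. A t \<subseteq> pow_space n) \<and>
     definable K (1 + n) {join 1 (\<lambda>_. t) y | t y. y \<in> A t}"

definition definably_meager ::
  "('a::{linordered_field, linorder_topology}, 'f, 'r) expansion \<Rightarrow> nat \<Rightarrow>
     (nat \<Rightarrow> 'a) set \<Rightarrow> (nat \<Rightarrow> 'a) set \<Rightarrow> bool" where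
  "definably_meager K n Y X \<longleftrightarrow> definable K n Y \<and> X \<subseteq> Y \<and>
     (\<exists>A. definable_family K n A \<and> (\<forall>t. nowhere_dense_in n Y (A t)) \<and> mono A \<and>
        X \<subseteq> (\<Union>t. A t))"

definition definably_residual ::
  "('a::{linordered_field, linorder_topology}, 'f, 'r) expansion \<Rightarrow> nat \<Rightarrow>
     (nat \<Rightarrow> 'a) set \<Rightarrow> (nat \<Rightarrow> 'a) set \<Rightarrow> bool" where
  "definably_residual K n Y X \<longleftrightarrow> X \<subseteq> Y \<and> definably_meager K n Y (Y - X)"

end

theory Submission
  imports Defs
begin

text \<open>Let \<open>A t\<close> be an increasing definable family of nowhere dense sets covering \<open>D\<close>, and let \<open>B s\<close> be
  the set of those \<open>x\<close> for which the section of \<open>A s\<close> at \<open>x\<close> is dense in some cube of side \<open>1 / s\<close>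
  with lower corner \<open>l\<close> in \<open>[-s, s]\<^sup>n\<close>. The sets \<open>B s\<close> increase and cover the complement of \<open>T\<close>.
  Suppose \<open>B s\<close> is dense in a box. Classically there are countably many cubes and the Baire category
  theorem applies; here \<open>s\<close> is fixed and a supremum replaces the pigeonhole principle: after
  shrinking the box, the first coordinate of \<open>l\<close> may be confined to an interval of length at most
  \<open>1 / (2 * s)\<close>, then the second one, and so on. A single cube then lies in all the cubes concerned,
  so \<open>A s\<close> is dense in a box of \<open>K\<^sup>m\<^sup>+\<^sup>n\<close>, a contradiction.\<close>

section \<open>Formulas and renaming\<close>

primrec trm_vars :: "'f trm \<Rightarrow> nat set" where
  "trm_vars (TVar i) = {i}"
| "trm_vars TZero = {}"
| "trm_vars TOne = {}"
| "trm_vars (TNeg s) = trm_vars s"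
| "trm_vars (TAdd s t) = trm_vars s \<union> trm_vars t"
| "trm_vars (TMul s t) = trm_vars s \<union> trm_vars t"
| "trm_vars (TFun f ts) = \<Union>(set (map trm_vars ts))"

text \<open>Bound variables are counted as well. What matters is that the set is finite and that the
  truth value does not depend on any variable outside it.\<close>

primrec fml_vars :: "('f, 'r) fml \<Rightarrow> nat set" where
  "fml_vars (FEq s t) = trm_vars s \<union> trm_vars t"
| "fml_vars (FLess s t) = trm_vars s \<union> trm_vars t"
| "fml_vars (FRel r ts) = \<Union>(set (map trm_vars ts))"
| "fml_vars (FNot p) = fml_vars p"
| "fml_vars (FAnd p q) = fml_vars p \<union> fml_vars q"
| "fml_vars (FEx i p) = insert i (fml_vars p)"

lemma finite_trm_vars: "finite (trm_vars t)"
  by (induction t) auto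

lemma finite_fml_vars: "finite (fml_vars p)"
  by (induction p) (auto simp: finite_trm_vars)

lemma trm_val_cong: "(\<And>i. i \<in> trm_vars t \<Longrightarrow> e i = e' i) \<Longrightarrow> trm_val K e t = trm_val K e' t"
proof (induction t)
  case (TFun f ts)
  then have "map (trm_val K e) ts = map (trm_val K e') ts"
    by (auto intro!: map_cong)
  then show ?case by (simp only: trm_val.simps)
next
  case (TAdd s t)
  then show ?case by (metis UnCI trm_val.simps(5) trm_vars.simps(5))
next
  case (TMul s t)
  then show ?case by (metis UnCI trm_val.simps(6) trm_vars.simps(6))
qed auto

lemma sat_cong: "(\<And>i. i \<in> fml_vars p \<Longrightarrow> e i = e' i) \<Longrightarrow> sat K e p = sat K e' p"
proof (induction p arbitrary: e e')
  case (FEq s t)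
  then have "trm_val K e s = trm_val K e' s" "trm_val K e t = trm_val K e' t"
    by (auto intro!: trm_val_cong)
  then show ?case by simp
next
  case (FLess s t)
  then have "trm_val K e s = trm_val K e' s" "trm_val K e t = trm_val K e' t"
    by (auto intro!: trm_val_cong)
  then show ?case by simp
next
  case (FRel r ts)
  then have "map (trm_val K e) ts = map (trm_val K e') ts"
    by (auto intro!: trm_val_cong map_cong)
  then show ?case by (simp only: sat.simps)
next
  case (FNot p)
  then show ?case by (metis fml_vars.simps(4) sat.simps(4))
next
  case (FAnd p q)
  then show ?case by (metis UnCI fml_vars.simps(5) sat.simps(5))
next
  case (FEx i p)
  have "sat K (e(i := a)) p = sat K (e'(i := a)) p" for a
    using FEx.prems by (intro FEx.IH) auto
  then show ?case by simp
qed

primrec trm_rename :: "(nat \<Rightarrow> nat) \<Rightarrow> 'f trm \<Rightarrow> 'f trm" where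
  "trm_rename h (TVar i) = TVar (h i)"
| "trm_rename h TZero = TZero"
| "trm_rename h TOne = TOne"
| "trm_rename h (TNeg s) = TNeg (trm_rename h s)"
| "trm_rename h (TAdd s t) = TAdd (trm_rename h s) (trm_rename h t)"
| "trm_rename h (TMul s t) = TMul (trm_rename h s) (trm_rename h t)"
| "trm_rename h (TFun f ts) = TFun f (map (trm_rename h) ts)"

text \<open>The renaming \<open>h\<close> need not be injective, so bound variables are renamed to fresh ones.\<close>

primrec fml_rename :: "(nat \<Rightarrow> nat) \<Rightarrow> ('f, 'r) fml \<Rightarrow> ('f, 'r) fml" where
  "fml_rename h (FEq s t) = FEq (trm_rename h s) (trm_rename h t)"
| "fml_rename h (FLess s t) = FLess (trm_rename h s) (trm_rename h t)"
| "fml_rename h (FRel r ts) = FRel r (map (trm_rename h) ts)"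
| "fml_rename h (FNot p) = FNot (fml_rename h p)"
| "fml_rename h (FAnd p q) = FAnd (fml_rename h p) (fml_rename h q)"
| "fml_rename h (FEx i p) =
     (let j = Suc (Max (insert 0 (h ` fml_vars p))) in FEx j (fml_rename (h(i := j)) p))"

lemma wf_trm_rename: "wf_trm K (trm_rename h t) = wf_trm K t"
proof (induction t)
  case (TFun f ts)
  then show ?case by (auto simp: list_all_iff)
qed auto

lemma wf_fml_rename: "wf_fml K (fml_rename h p) = wf_fml K p"
proof (induction p arbitrary: h)
  case (FRel r ts)
  then show ?case by (auto simp: list_all_iff wf_trm_rename)
qed (auto simp: wf_trm_rename Let_def)

lemma trm_val_rename: "trm_val K e (trm_rename h t) = trm_val K (e \<circ> h) t"
proof (induction t)
  case (TFun f ts)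
  then have "map (trm_val K e \<circ> trm_rename h) ts = map (trm_val K (e \<circ> h)) ts"
    by (auto simp: comp_def)
  then show ?case by (simp only: trm_rename.simps trm_val.simps map_map)
qed auto

text \<open>This lets variables be moved freely: to make those of two formulas disjoint, to free one
  for a quantifier, and to separate coordinates from parameters.\<close>

lemma sat_rename: "sat K e (fml_rename h p) = sat K (e \<circ> h) p"
proof (induction p arbitrary: e h)
  case (FRel r ts)
  have "map (trm_val K e \<circ> trm_rename h) ts = map (trm_val K (e \<circ> h)) ts"
    by (simp add: trm_val_rename)
  then show ?case by (simp only: fml_rename.simps sat.simps map_map)
next
  case (FEx i p)
  define j where "j = Suc (Max (insert 0 (h ` fml_vars p)))"
  have j: "h v \<noteq> j" if "v \<in> fml_vars p" for v
  proof -
    have "h v \<le> Max (insert 0 (h ` fml_vars p))"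
      using that by (intro Max_ge) (auto simp: finite_fml_vars)
    then show ?thesis by (simp add: j_def)
  qed
  \<comment> \<open>Since \<open>h\<close> maps no variable of \<open>p\<close> to \<open>j\<close>,
    changing the environment at \<open>j\<close> affects only the renamed variable
    \<open>i\<close>.\<close>
  have "sat K (e(j := a)) (fml_rename (h(i := j)) p) = sat K ((e \<circ> h)(i := a)) p" for a
    unfolding FEx.IH using j by (intro sat_cong) auto
  then show ?case by (simp add: j_def[symmetric] Let_def del: fun_upd_apply comp_apply)
qed (auto simp: trm_val_rename)

section \<open>Definable predicates\<close>

text \<open>An environment \<open>E\<close> assigns to every \<open>k\<close> a tuple \<open>E k\<close>; a code is a coordinate of one of
  these tuples or a parameter.\<close>

definition code_val :: "(nat \<Rightarrow> nat \<Rightarrow> 'a) \<Rightarrow> (nat \<times> nat) + 'a \<Rightarrow> 'a" where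
  "code_val E v = (case v of Inl (k, i) \<Rightarrow> E k i | Inr a \<Rightarrow> a)"

lemma code_val_simps [simp]: "code_val E (Inl (k, i)) = E k i" "code_val E (Inr a) = a"
  by (auto simp: code_val_def)

text \<open>These are the functions that can be substituted for variables by changing codes alone,
  with the formula left as it is.\<close>

definition simple_fun :: "((nat \<Rightarrow> nat \<Rightarrow> 'a) \<Rightarrow> 'a) \<Rightarrow> bool" where
  "simple_fun g \<longleftrightarrow> (\<exists>v. g = (\<lambda>E. code_val E v))"

text \<open>Predicates of an environment replace subsets of a fixed power of \<open>K\<close>:
  connectives and quantifiers over named tuples then need no bookkeeping of arities. The map
  \<open>f\<close> says which coordinate or parameter each variable stands for.\<close>

definition definable_pred ::
  "('a::linordered_field, 'f, 'r) expansion \<Rightarrow> ((nat \<Rightarrow> nat \<Rightarrow> 'a) \<Rightarrow> bool) \<Rightarrow> bool" where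
  "definable_pred K P \<longleftrightarrow>
     (\<exists>p f. wf_fml K p \<and> (\<forall>E. P E = sat K (\<lambda>i. code_val E (f i)) p))"

lemma simple_fun_coord [intro!, simp]: "simple_fun (\<lambda>E. E k i)"
  unfolding simple_fun_def by (rule exI[of _ "Inl (k, i)"]) simp

lemma simple_fun_const [intro!, simp]: "simple_fun (\<lambda>E. a)"
  unfolding simple_fun_def by (rule exI[of _ "Inr a"]) simp

lemma definable_predI:
  assumes "wf_fml K p" "\<And>i. simple_fun (g i)" "\<And>E. P E = sat K (\<lambda>i. g i E) p"
  shows "definable_pred K P"
proof -
  obtain f where f: "\<And>i. g i = (\<lambda>E. code_val E (f i))"
    using assms(2) unfolding simple_fun_def by metis
  show ?thesis
    unfolding definable_pred_def using assms(1,3) f by auto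
qed

lemma definable_predE:
  assumes "definable_pred K P"
  obtains p f where "wf_fml K p" "P = (\<lambda>E. sat K (\<lambda>i. code_val E (f i)) p)"
  using assms unfolding definable_pred_def by fast

lemma definable_pred_subst:
  assumes "definable_pred K P" "\<And>k i. simple_fun (\<lambda>E. g E k i)"
  shows "definable_pred K (\<lambda>E. P (g E))"
proof -
  obtain p f where p: "wf_fml K p" "P = (\<lambda>E. sat K (\<lambda>i. code_val E (f i)) p)"
    using assms(1) by (rule definable_predE)
  have "simple_fun (\<lambda>E. code_val (g E) (f i))" for i
    by (cases "f i") (auto simp: assms(2))
  then show ?thesis
    using p by (intro definable_predI[where p = p and g = "\<lambda>i E. code_val (g E) (f i)"]) auto
qed

lemma definable_pred_less [intro!]:
  assumes "simple_fun s" "simple_fun t"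
  shows "definable_pred K (\<lambda>E. s E < t E)"
  by (rule definable_predI[where p = "FLess (TVar 0) (TVar 1)" and g = "\<lambda>i. if i = 0 then s else t"])
    (auto simp: assms)

lemma definable_pred_not [intro!]:
  assumes "definable_pred K P"
  shows "definable_pred K (\<lambda>E. \<not> P E)"
proof -
  obtain p f where p: "wf_fml K p" "P = (\<lambda>E. sat K (\<lambda>i. code_val E (f i)) p)"
    using assms by (rule definable_predE)
  then show ?thesis
    unfolding definable_pred_def by (intro exI[of _ "FNot p"] exI[of _ f]) auto
qed

lemma definable_pred_le [intro]:
  assumes "simple_fun s" "simple_fun t"
  shows "definable_pred K (\<lambda>E. s E \<le> t E)"
  using definable_pred_not[OF definable_pred_less[OF assms(2,1)]] by (simp add: not_less)

lemma definable_pred_conj [intro!]: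
  assumes "definable_pred K P" "definable_pred K Q"
  shows "definable_pred K (\<lambda>E. P E \<and> Q E)"
proof -
  obtain p f where p: "wf_fml K p" "P = (\<lambda>E. sat K (\<lambda>i. code_val E (f i)) p)"
    using assms(1) by (rule definable_predE)
  obtain q g where q: "wf_fml K q" "Q = (\<lambda>E. sat K (\<lambda>i. code_val E (g i)) q)"
    using assms(2) by (rule definable_predE)
  \<comment> \<open>The two formulas may use the same variable with different codes, so the even
    variables are given to \<open>p\<close> and the odd ones to \<open>q\<close>.\<close>
  define h where "h i = (if even i then f (i div 2) else g (i div 2))" for i :: nat
  define r where "r = FAnd (fml_rename (\<lambda>i. 2 * i) p) (fml_rename (\<lambda>i. 2 * i + 1) q)"
  have "wf_fml K r"
    using p q by (simp add: r_def wf_fml_rename)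
  moreover have "(P E \<and> Q E) = sat K (\<lambda>i. code_val E (h i)) r" for E
    by (simp add: p q r_def sat_rename h_def comp_def)
  ultimately show ?thesis unfolding definable_pred_def by blast
qed

lemma definable_pred_imp [intro!]:
  assumes "definable_pred K P" "definable_pred K Q"
  shows "definable_pred K (\<lambda>E. P E \<longrightarrow> Q E)"
  using definable_pred_not[OF definable_pred_conj[OF assms(1) definable_pred_not[OF assms(2)]]]
  by simp

lemma definable_pred_ball [intro!]:
  fixes n :: nat
  assumes "\<And>i. i < n \<Longrightarrow> definable_pred K (P i)"
  shows "definable_pred K (\<lambda>E. \<forall>i<n. P i E)"
  using assms
proof (induction n)
  case 0
  \<comment> \<open>The empty conjunction is represented by a true atomic formula.\<close>
  have "definable_pred K (\<lambda>E. 0 < (1::'a))" by (rule definable_pred_less) auto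
  then show ?case by simp
next
  case (Suc n)
  then have "definable_pred K (\<lambda>E. (\<forall>i<n. P i E) \<and> P n E)"
    by (intro definable_pred_conj) auto
  then show ?case by (simp add: less_Suc_eq all_conj_distrib imp_disjL conj_commute)
qed

section \<open>Quantifiers over elements and tuples\<close>

lemma definable_pred_ex1:
  assumes "definable_pred K P"
  shows "definable_pred K (\<lambda>E. \<exists>a. P (E(k := (E k)(i := a))))"
proof -
  obtain p f where p: "wf_fml K p" "P = (\<lambda>E. sat K (\<lambda>i. code_val E (f i)) p)"
    using assms(1) by (rule definable_predE)
  obtain j where j: "j \<notin> fml_vars p"
    using finite_fml_vars ex_new_if_finite infinite_UNIV_nat by blast
  \<comment> \<open>Several variables may carry the code of the quantified coordinate; all of them
    are merged into the fresh variable \<open>j\<close>, which is then bound.\<close>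
  define h where "h v = (if f v = Inl (k, i) then j else v)" for v
  have "sat K ((\<lambda>v. code_val E (f v))(j := a)) (fml_rename h p) = P (E(k := (E k)(i := a)))" for E a
    unfolding sat_rename p
  proof (rule sat_cong)
    fix v assume "v \<in> fml_vars p"
    then have "v \<noteq> j" using j by auto
    then show "((\<lambda>v. code_val E (f v))(j := a) \<circ> h) v = code_val (E(k := (E k)(i := a))) (f v)"
      by (cases "f v") (force simp: h_def)+
  qed
  then show ?thesis
    unfolding definable_pred_def
    by (intro exI[of _ "FEx j (fml_rename h p)"] exI[of _ f]) (auto simp: wf_fml_rename p)
qed

text \<open>The coordinates are quantified one at a time: the quantifier over coordinate
  \<open>N\<close> is absorbed into the predicate, hence the induction over arbitrary
  \<open>P\<close>.\<close>

lemma definable_pred_ex_less: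
  assumes "definable_pred K P"
  shows "definable_pred K (\<lambda>E. \<exists>z. P (E(k := (\<lambda>i. if i < N then z i else E k i))))"
  using assms
proof (induction N arbitrary: P)
  case 0
  then show ?case by simp
next
  case (Suc N)
  have eq: "(\<exists>z. P (E(k := (\<lambda>i. if i < Suc N then z i else E k i)))) \<longleftrightarrow>
    (\<exists>z a. P ((E(k := (\<lambda>i. if i < N then z i else E k i)))
         (k := ((E(k := (\<lambda>i. if i < N then z i else E k i))) k)(N := a))))" (is "?L \<longleftrightarrow> ?R") for E
  proof
    assume ?L
    then obtain z where z: "P (E(k := (\<lambda>i. if i < Suc N then z i else E k i)))" by blast
    have "(\<lambda>i. if i < Suc N then z i else E k i) = (\<lambda>i. if i < N then z i else E k i)(N := z N)"
      by (auto simp: less_Suc_eq)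
    then show ?R using z by (intro exI[of _ z] exI[of _ "z N"]) simp
  next
    assume ?R
    then obtain z a where z: "P (E(k := (\<lambda>i. if i < N then z i else E k i)(N := a)))" by auto
    have "(\<lambda>i. if i < Suc N then (z(N := a)) i else E k i) = (\<lambda>i. if i < N then z i else E k i)(N := a)"
      by (auto simp: less_Suc_eq)
    then show ?L using z by (intro exI[of _ "z(N := a)"]) simp
  qed
  show ?case
    unfolding eq by (rule Suc.IH[OF definable_pred_ex1[OF Suc.prems]])
qed

text \<open>Although the tuple \<open>z\<close> is infinite, this is a finite quantification, as a formula mentions
  only finitely many coordinates.\<close>

lemma definable_pred_ex:
  assumes "definable_pred K P"
  shows "definable_pred K (\<lambda>E. \<exists>z. P (E(k := z)))"
proof -
  obtain p f where p: "wf_fml K p" "P = (\<lambda>E. sat K (\<lambda>i. code_val E (f i)) p)"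
    using assms(1) by (rule definable_predE)
  define J where "J = {j. Inl (k, j) \<in> f ` fml_vars p}"
  have "(\<lambda>j. Inl (k, j)) ` J \<subseteq> f ` fml_vars p" by (auto simp: J_def)
  then have "finite ((\<lambda>j. Inl (k, j) :: (nat \<times> nat) + 'a) ` J)"
    by (rule finite_subset) (simp add: finite_fml_vars)
  then have "finite J"
    by (rule finite_imageD) (auto simp: inj_on_def)
  then obtain N where N: "j < N" if "j \<in> J" for j
    unfolding finite_nat_set_iff_bounded by blast
  have *: "P (E(k := (\<lambda>i. if i < N then z i else E k i))) = P (E(k := z))" for E z
    unfolding p
  proof (rule sat_cong)
    fix v assume v: "v \<in> fml_vars p"
    show "code_val (E(k := (\<lambda>i. if i < N then z i else E k i))) (f v) = code_val (E(k := z)) (f v)"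
    proof (cases "f v")
      case (Inl w)
      have "j < N" if "w = (k, j)" for j
        by (rule N) (use Inl v that in \<open>force simp: J_def\<close>)
      then show ?thesis using Inl by (cases w) auto
    qed auto
  qed
  show ?thesis
    using definable_pred_ex_less[OF assms, of k N] by (simp add: *)
qed

lemma definable_pred_all:
  assumes "definable_pred K P"
  shows "definable_pred K (\<lambda>E. \<forall>z. P (E(k := z)))"
  using definable_pred_not[OF definable_pred_ex[OF definable_pred_not[OF assms]]] by simp

section \<open>Passage between definable predicates and definable sets\<close>

lemma definable_Collect:
  assumes "definable_pred K P"
  shows "definable K n {u \<in> pow_space n. P (\<lambda>_. u)}"
proof -
  obtain p f where p: "wf_fml K p" "P = (\<lambda>E. sat K (\<lambda>i. code_val E (f i)) p)"
    using assms(1) by (rule definable_predE)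
  \<comment> \<open>A variable that stands for a coordinate below \<open>n\<close> becomes that
    coordinate; every other one moves to a position from \<open>n\<close> onwards, where the
    parameters are.\<close>
  define h where
    "h v = (case f v of Inl (k, j) \<Rightarrow> if j < n then j else n + v | Inr a \<Rightarrow> n + v)" for v
  \<comment> \<open>A point of \<open>pow_space n\<close> has the value \<open>undefined\<close> at
    each coordinate from \<open>n\<close> onwards, so such a coordinate is treated as a parameter
    with this value.\<close>
  define c where "c v = code_val (\<lambda>_ _. undefined) (f v)" for v
  have "P (\<lambda>_. u) = sat K (join n u c) (fml_rename h p)" if "u \<in> pow_space n" for u
  proof -
    have "code_val (\<lambda>_. u) (f v) = join n u c (h v)" for v
      using that by (auto simp: h_def c_def join_def pow_space_def code_val_def split: sum.split)
    then show ?thesis by (simp add: p sat_rename comp_def)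
  qed
  then show ?thesis
    unfolding definable_def
    by (intro exI[of _ "fml_rename h p"] exI[of _ c]) (auto simp: wf_fml_rename p)
qed

text \<open>The tuples of an environment are arbitrary functions, whereas points of
  \<open>pow_space n\<close> are \<open>undefined\<close> from \<open>n\<close> onwards; hence the
  restriction.\<close>

lemma definable_pred_mem:
  assumes "definable K n X" "\<And>i. simple_fun (\<lambda>E. g E i)"
  shows "definable_pred K (\<lambda>E. restrict (g E) {..<n} \<in> X)"
proof -
  obtain p c where p: "wf_fml K p" "X = {x \<in> pow_space n. sat K (join n x c) p}"
    using assms(1) unfolding definable_def by blast
  have "simple_fun (\<lambda>E. if i < n then g E i else c (i - n))" for i
    by (cases "i < n") (auto simp: assms(2))
  moreover have "join n (restrict (g E) {..<n}) c = (\<lambda>i. if i < n then g E i else c (i - n))" for E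
    by (auto simp: join_def)
  ultimately show ?thesis
    by (intro definable_predI[where p = p and g = "\<lambda>i E. if i < n then g E i else c (i - n)"])
      (auto simp: p pow_space_def)
qed

lemma definable_pow_space: "definable K n (pow_space n)"
proof -
  have "definable_pred K (\<lambda>E. True)"
    using definable_pred_le[of "\<lambda>E. E 0 0" "\<lambda>E. E 0 0" K] by simp
  from definable_Collect[OF this] show ?thesis by simp
qed

section \<open>Boxes and suprema\<close>

definition in_box :: "nat \<Rightarrow> (nat \<Rightarrow> 'a::linorder) \<Rightarrow> (nat \<Rightarrow> 'a) \<Rightarrow> (nat \<Rightarrow> 'a) \<Rightarrow> bool" where
  "in_box n a b x \<longleftrightarrow> (\<forall>i<n. a i < x i \<and> x i < b i)"

text \<open>Boxes are open, so their faces may coincide; the strict inequality keeps the smaller box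
  nonempty when the order is dense.\<close>

definition subbox ::
  "nat \<Rightarrow> (nat \<Rightarrow> 'a::linorder) \<Rightarrow> (nat \<Rightarrow> 'a) \<Rightarrow> (nat \<Rightarrow> 'a) \<Rightarrow> (nat \<Rightarrow> 'a) \<Rightarrow> bool" where
  "subbox n a b a' b' \<longleftrightarrow> (\<forall>i<n. a i \<le> a' i \<and> a' i < b' i \<and> b' i \<le> b i)"

lemma subbox_trans: "subbox n a b a' b' \<Longrightarrow> subbox n a' b' a'' b'' \<Longrightarrow> subbox n a b a'' b''"
  unfolding subbox_def by (meson order.trans)

lemma subbox_refl: "subbox n a b a b \<longleftrightarrow> (\<forall>i<n. a i < b i)"
  unfolding subbox_def by auto

lemma in_box_mono: "subbox n a b a' b' \<Longrightarrow> in_box n a' b' x \<Longrightarrow> in_box n a b x"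
  unfolding subbox_def in_box_def by (meson order.strict_trans1 order.strict_trans2)

lemma definable_pred_in_box [intro!]:
  assumes "\<And>i. simple_fun (\<lambda>E. a E i)" "\<And>i. simple_fun (\<lambda>E. b E i)" "\<And>i. simple_fun (\<lambda>E. x E i)"
  shows "definable_pred K (\<lambda>E. in_box n (a E) (b E) (x E))"
  unfolding in_box_def by (intro definable_pred_ball definable_pred_conj definable_pred_less assms)

lemma definable_pred_subbox [intro!]:
  assumes "\<And>i. simple_fun (\<lambda>E. a E i)" "\<And>i. simple_fun (\<lambda>E. b E i)"
    "\<And>i. simple_fun (\<lambda>E. a' E i)" "\<And>i. simple_fun (\<lambda>E. b' E i)"
  shows "definable_pred K (\<lambda>E. subbox n (a E) (b E) (a' E) (b' E))"
  unfolding subbox_def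
  by (intro definable_pred_ball definable_pred_conj definable_pred_less definable_pred_le assms)

section \<open>Definable suprema and the pigeonhole principle\<close>

lemma definably_complete_lub:
  fixes K :: "('a::linordered_field, 'f, 'r) expansion"
  assumes "definably_complete K" and "definable_pred K (\<lambda>E. P (E 0 0))"
    and "P a" and bdd: "\<And>x. P x \<Longrightarrow> x \<le> M"
  obtains c where "\<And>x. P x \<Longrightarrow> x \<le> c" "\<And>d. d < c \<Longrightarrow> \<exists>x. P x \<and> d < x"
proof -
  have "definable K 1 {x \<in> pow_space 1. x 0 \<in> {x. P x}}"
    using definable_Collect[OF assms(2), of 1] by simp
  then obtain s where s: "isLub UNIV (Fin ` {x. P x}) s"
    using assms(1) unfolding definably_complete_def by blast
  have ub: "Fin x \<le> s" if "P x" for x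
    using s that by (auto simp: isLub_def isUb_def leastP_def setle_def)
  have lub: "s \<le> Fin d" if "\<And>x. P x \<Longrightarrow> x \<le> d" for d
    using s that by (auto simp: isLub_def isUb_def leastP_def setle_def setge_def)
  \<comment> \<open>The element \<open>a\<close> excludes minus infinity and the bound
    \<open>M\<close> excludes plus infinity.\<close>
  obtain c where "s = Fin c"
    using ub[OF \<open>P a\<close>] lub[of M] bdd by (cases s) auto
  show ?thesis
  proof (rule that[of c])
    show "x \<le> c" if "P x" for x using ub[OF that] \<open>s = Fin c\<close> by simp
    show "\<exists>x. P x \<and> d < x" if "d < c" for d
      using lub[of d] \<open>s = Fin c\<close> that by (force simp: not_less)
  qed
qed

text \<open>The number \<open>c\<close> is the supremum, over all subboxes, of the infimum of the \<open>j\<close>-th coordinates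
  \<open>l j\<close> occurring over the subbox.\<close>

lemma pigeonhole_step:
  fixes K :: "('a::linordered_field, 'f, 'r) expansion"
  assumes K: "definably_complete K" and G: "definable_pred K (\<lambda>E. G (E 0) (E 1))"
    and bdd: "\<And>x l. G x l \<Longrightarrow> -s \<le> l j \<and> l j \<le> s"
    and pq: "\<forall>i<m. p i < q i"
    and dense: "\<And>a b. subbox m p q a b \<Longrightarrow> \<exists>x l. in_box m a b x \<and> G x l"
    and "0 < \<delta>"
  obtains c p' q' where "subbox m p q p' q'"
    "\<And>a b. subbox m p' q' a b \<Longrightarrow> \<exists>x l. in_box m a b x \<and> G x l \<and> c - \<delta> < l j \<and> l j < c + \<delta>"
proof -
  define P where "P t \<longleftrightarrow> (\<exists>a b. subbox m p q a b \<and> (\<forall>x l. in_box m a b x \<and> G x l \<longrightarrow> t < l j))" for t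
  \<comment> \<open>Roles of the tuples: \<open>E 0 0\<close> is the bound \<open>t\<close>,
    \<open>E 1\<close> and \<open>E 2\<close> are the corners of the subbox, \<open>E 3\<close> is
    \<open>x\<close> and \<open>E 4\<close> is \<open>l\<close>.\<close>
  have "definable_pred K (\<lambda>E. G (E 3) (E 4))"
    using definable_pred_subst[OF G, of "\<lambda>E k. E (k + 3)"] by simp
  then have 1: "definable_pred K (\<lambda>E. in_box m (E 1) (E 2) (E 3) \<and> G (E 3) (E 4) \<longrightarrow> E 0 0 < E 4 j)"
    by auto
  have "definable_pred K (\<lambda>E. \<forall>x l. in_box m (E 1) (E 2) x \<and> G x l \<longrightarrow> E 0 0 < l j)"
    using definable_pred_all[OF definable_pred_all[OF 1, of 4], of 3] by simp
  then have 2: "definable_pred K (\<lambda>E. subbox m p q (E 1) (E 2) \<and>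
      (\<forall>x l. in_box m (E 1) (E 2) x \<and> G x l \<longrightarrow> E 0 0 < l j))"
    by auto
  have P: "definable_pred K (\<lambda>E. P (E 0 0))"
    using definable_pred_ex[OF definable_pred_ex[OF 2, of 2], of 1] by (simp add: P_def)
  have "subbox m p q p q" using pq by (simp add: subbox_refl)
  moreover have "- s - 1 < l j" if "G x l" for x l
  proof -
    have "- s - 1 < - s" by simp
    also have "\<dots> \<le> l j" using bdd[OF that] by blast
    finally show ?thesis .
  qed
  ultimately have P0: "P (- s - 1)" unfolding P_def by blast
  have "t \<le> s" if t: "P t" for t
  proof -
    obtain a b where ab: "subbox m p q a b" "\<And>x l. in_box m a b x \<Longrightarrow> G x l \<Longrightarrow> t < l j"
      using t unfolding P_def by blast
    obtain x l where "in_box m a b x" "G x l" using dense[OF ab(1)] by blast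
    then show ?thesis using ab(2) bdd by (meson less_imp_le order_trans)
  qed
  from definably_complete_lub[OF K P P0 this]
  obtain c where c: "\<And>t. P t \<Longrightarrow> t \<le> c" "\<And>d. d < c \<Longrightarrow> \<exists>t. P t \<and> d < t" by metis
  \<comment> \<open>A lower bound close to \<open>c\<close> is attained on one subbox and persists
    on all smaller ones; this subbox is the result.\<close>
  obtain t where t: "P t" "c - \<delta> < t" using c(2)[of "c - \<delta>"] \<open>0 < \<delta>\<close> by fastforce
  then obtain p' q' where pq': "subbox m p q p' q'" "\<And>x l. in_box m p' q' x \<Longrightarrow> G x l \<Longrightarrow> t < l j"
    unfolding P_def by blast
  obtain d where d: "c < d" "d < c + \<delta>" using \<open>0 < \<delta>\<close> Orderings.dense[of c "c + \<delta>"] by auto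
  show ?thesis
  proof (rule that[OF pq'(1)])
    fix a b assume ab: "subbox m p' q' a b"
    \<comment> \<open>As \<open>d\<close> exceeds the supremum, it is not a strict lower bound on
      any subbox, so each of them has a value \<open>l j\<close> not above \<open>d\<close>.\<close>
    have "\<not> P d" using c(1)[of d] d(1) by auto
    then obtain x l where xl: "in_box m a b x" "G x l" "l j \<le> d"
      unfolding P_def using subbox_trans[OF pq'(1) ab] by (meson not_less)
    moreover have "t < l j" using pq'(2) in_box_mono[OF ab xl(1)] xl(2) by blast
    ultimately show "\<exists>x l. in_box m a b x \<and> G x l \<and> c - \<delta> < l j \<and> l j < c + \<delta>"
      using d(2) t(2) by (meson order.strict_trans order.strict_trans1)
  qed
qed

text \<open>Induction on \<open>n\<close>: the relation \<open>G\<close> is strengthened by the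
  confinement of the first \<open>n\<close> coordinates of \<open>l\<close>. Its density in every
  subbox is the induction hypothesis, and \<open>pigeonhole_step\<close> then confines coordinate
  \<open>n\<close>.\<close>

lemma pigeonhole:
  fixes K :: "('a::linordered_field, 'f, 'r) expansion"
  assumes K: "definably_complete K" and G: "definable_pred K (\<lambda>E. G (E 0) (E 1))"
    and bdd: "\<And>x l j. G x l \<Longrightarrow> j < n \<Longrightarrow> -s \<le> l j \<and> l j \<le> s"
    and pq: "\<forall>i<m. p i < q i"
    and dense: "\<And>a b. subbox m p q a b \<Longrightarrow> \<exists>x l. in_box m a b x \<and> G x l"
    and \<delta>: "0 < \<delta>"
  shows "\<exists>c p' q'. subbox m p q p' q' \<and> (\<forall>a b. subbox m p' q' a b \<longrightarrow>
    (\<exists>x l. in_box m a b x \<and> G x l \<and> in_box n (\<lambda>i. c i - \<delta>) (\<lambda>i. c i + \<delta>) l))"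
  using bdd
proof (induction n)
  case 0
  have "subbox m p q p q" using pq by (simp add: subbox_refl)
  then show ?case using dense by (auto simp: in_box_def[of 0])
next
  case (Suc n)
  then obtain c p' q' where IH: "subbox m p q p' q'" "\<And>a b. subbox m p' q' a b \<Longrightarrow>
    \<exists>x l. in_box m a b x \<and> G x l \<and> in_box n (\<lambda>i. c i - \<delta>) (\<lambda>i. c i + \<delta>) l"
    by auto
  let ?G = "\<lambda>x l. G x l \<and> in_box n (\<lambda>i. c i - \<delta>) (\<lambda>i. c i + \<delta>) l"
  have G': "definable_pred K (\<lambda>E. ?G (E 0) (E 1))"
    using G by auto
  have pq': "\<forall>i<m. p' i < q' i" using IH(1) by (auto simp: subbox_def)
  obtain c' p'' q'' where step: "subbox m p' q' p'' q''" "\<And>a b. subbox m p'' q'' a b \<Longrightarrow>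
    \<exists>x l. in_box m a b x \<and> ?G x l \<and> c' - \<delta> < l n \<and> l n < c' + \<delta>"
    by (rule pigeonhole_step[OF K G' _ pq' IH(2) \<delta>, of s n]) (use Suc.prems in auto)
  show ?case
  proof (rule exI[of _ "c(n := c')"], rule exI[of _ p''], rule exI[of _ q''], intro conjI allI impI)
    show "subbox m p q p'' q''" using subbox_trans[OF IH(1) step(1)] .
    fix a b assume "subbox m p'' q'' a b"
    from step(2)[OF this] obtain x l where "in_box m a b x" "?G x l" "c' - \<delta> < l n" "l n < c' + \<delta>"
      by blast
    then show "\<exists>x l. in_box m a b x \<and> G x l \<and>
        in_box (Suc n) (\<lambda>i. (c(n := c')) i - \<delta>) (\<lambda>i. (c(n := c')) i + \<delta>) l"
      by (intro exI[of _ x] exI[of _ l]) (auto simp: in_box_def less_Suc_eq)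
  qed
qed

section \<open>Nowhere dense sets\<close>

lemma topspace_pow_top: "topspace (pow_top n) = pow_space n"
  by (simp add: pow_top_def pow_space_def)

lemma subtopology_pow_space: "subtopology (pow_top n) (pow_space n) = pow_top n"
  by (metis subtopology_topspace topspace_pow_top)

lemma nowhere_dense_in_pow_space:
  "nowhere_dense_in n (pow_space n) X \<longleftrightarrow>
     X \<subseteq> pow_space n \<and> pow_top n interior_of (pow_top n closure_of X) = {}"
  by (simp add: nowhere_dense_in_def subtopology_pow_space)

lemma openin_box: "openin (pow_top n) {x \<in> pow_space n. in_box n a b x}"
proof -
  have "{x \<in> pow_space n. in_box n a b x} = (\<Pi>\<^sub>E i\<in>{..<n}. {a i<..<b i})"
    unfolding pow_space_def in_box_def PiE_iff set_eq_iff mem_Collect_eq greaterThanLessThan_iff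
    by blast
  moreover have "\<forall>i\<in>{..<n}. openin euclidean {a i<..<b i}"
    unfolding open_openin[symmetric] by (intro ballI open_greaterThanLessThan)
  then have "openin (pow_top n) (\<Pi>\<^sub>E i\<in>{..<n}. {a i<..<b i})"
    unfolding pow_top_def openin_PiE[OF finite_lessThan] by (rule disjI2)
  ultimately show ?thesis by (simp only:)
qed

lemma box_nonempty:
  fixes a b :: "nat \<Rightarrow> 'a::dense_linorder"
  assumes "\<forall>i<n. a i < b i"
  obtains x where "x \<in> pow_space n" "in_box n a b x"
proof -
  have "\<forall>i. \<exists>y. i < n \<longrightarrow> a i < y \<and> y < b i"
    using assms dense by blast
  then obtain x where "\<forall>i<n. a i < x i \<and> x i < b i"
    by metis
  then show ?thesis
    by (intro that[of "restrict x {..<n}"]) (auto simp: pow_space_def in_box_def)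
qed

lemma interval_basis:
  fixes x :: "'a::{linorder_topology, no_top, no_bot}"
  assumes "open V" "x \<in> V"
  shows "\<exists>a b. a < x \<and> x < b \<and> {a<..<b} \<subseteq> V"
proof -
  obtain y z where "x < y" "z < x" using gt_ex lt_ex by meson
  obtain b where b: "x < b" "{x..<b} \<subseteq> V" using open_right[OF assms \<open>x < y\<close>] by auto
  obtain a where a: "a < x" "{a<..x} \<subseteq> V" using open_left[OF assms \<open>z < x\<close>] by auto
  have "{a<..<b} \<subseteq> {a<..x} \<union> {x..<b}" by auto
  then show ?thesis using a b by blast
qed

lemma box_basis:
  fixes U :: "(nat \<Rightarrow> 'a::{linorder_topology, no_top, no_bot}) set"
  assumes "openin (pow_top n) U" "x \<in> U"
  obtains a b where "in_box n a b x" "\<And>y. y \<in> pow_space n \<Longrightarrow> in_box n a b y \<Longrightarrow> y \<in> U"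
proof -
  have "\<exists>V. finite {i \<in> {..<n}. V i \<noteq> topspace euclidean} \<and>
      (\<forall>i\<in>{..<n}. openin euclidean (V i)) \<and> x \<in> Pi\<^sub>E {..<n} V \<and> Pi\<^sub>E {..<n} V \<subseteq> U"
    using assms unfolding pow_top_def openin_product_topology_alt by blast
  then obtain V where V: "\<forall>i\<in>{..<n}. open (V i)" "x \<in> Pi\<^sub>E {..<n} V" "Pi\<^sub>E {..<n} V \<subseteq> U"
    unfolding open_openin[symmetric] by blast
  have "\<forall>i<n. \<exists>a b. a < x i \<and> x i < b \<and> {a<..<b} \<subseteq> V i"
    using V by (intro allI impI interval_basis) auto
  then obtain a b where ab: "\<And>i. i < n \<Longrightarrow> a i < x i \<and> x i < b i \<and> {a i<..<b i} \<subseteq> V i"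
    by metis
  show ?thesis
  proof (rule that[of a b])
    show "in_box n a b x" using ab by (auto simp: in_box_def)
    fix y assume y: "y \<in> pow_space n" "in_box n a b y"
    have "y i \<in> V i" if "i < n" for i
      using ab[OF that] y(2) that by (auto simp: in_box_def)
    then have "y \<in> Pi\<^sub>E {..<n} V"
      using y(1) by (auto simp: pow_space_def PiE_iff)
    then show "y \<in> U" using V(3) by blast
  qed
qed

text \<open>From here on the topology enters only through this criterion, which speaks of
  coordinates and the order alone.\<close>

lemma nowhere_dense_in_boxes:
  fixes X :: "(nat \<Rightarrow> 'a::{linorder_topology, no_top, no_bot, dense_linorder}) set"
  shows "nowhere_dense_in n (pow_space n) X \<longleftrightarrow> X \<subseteq> pow_space n \<and>
    (\<forall>a b. (\<forall>i<n. a i < b i) \<longrightarrow> (\<exists>a' b'. subbox n a b a' b' \<and> (\<forall>x\<in>X. \<not> in_box n a' b' x)))"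
    (is "_ \<longleftrightarrow> _ \<and> (\<forall>a b. ?Q a b)")
proof (intro iffI conjI allI; (elim conjE)?)
  assume nd: "nowhere_dense_in n (pow_space n) X"
  then show X: "X \<subseteq> pow_space n" by (simp add: nowhere_dense_in_pow_space)
  fix a b show "?Q a b"
  proof
    assume "\<forall>i<n. a i < b i"
    define B where "B = {x \<in> pow_space n. in_box n a b x}"
    have "B \<noteq> {}" using box_nonempty[OF \<open>\<forall>i<n. a i < b i\<close>] by (force simp: B_def)
    moreover have "B \<subseteq> pow_top n interior_of (pow_top n closure_of X)" if "B \<subseteq> pow_top n closure_of X"
      using that by (rule interior_of_maximal) (simp add: B_def openin_box)
    \<comment> \<open>Otherwise the nonempty open box \<open>B\<close> would lie in the interior of
      the closure.\<close>
    ultimately obtain z where z: "z \<in> B - pow_top n closure_of X"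
      using nd by (auto simp: nowhere_dense_in_pow_space)
    have "openin (pow_top n) (B - pow_top n closure_of X)"
      unfolding B_def by (intro openin_diff openin_box closedin_closure_of)
    from box_basis[OF this z] obtain c d where cd: "in_box n c d z"
        "\<And>y. y \<in> pow_space n \<Longrightarrow> in_box n c d y \<Longrightarrow> y \<in> B - pow_top n closure_of X"
      by metis
    \<comment> \<open>The intersection of the given box with the box found around \<open>z\<close>;
      it is nondegenerate because \<open>z\<close> lies in both.\<close>
    let ?a = "\<lambda>i. max (a i) (c i)" and ?b = "\<lambda>i. min (b i) (d i)"
    have "subbox n a b ?a ?b"
      using cd(1) z by (auto simp: subbox_def B_def in_box_def intro: less_trans)
    moreover have "\<not> in_box n ?a ?b x" if "x \<in> X" for x
    proof
      assume "in_box n ?a ?b x"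
      then have "in_box n c d x" by (auto simp: in_box_def)
      then show False
        using cd(2)[of x] X that closure_of_subset[of X "pow_top n"] by (auto simp: topspace_pow_top)
    qed
    ultimately show "\<exists>a' b'. subbox n a b a' b' \<and> (\<forall>x\<in>X. \<not> in_box n a' b' x)" by blast
  qed
next
  assume X: "X \<subseteq> pow_space n" and Q: "\<forall>a b. ?Q a b"
  have False if "z \<in> pow_top n interior_of (pow_top n closure_of X)" for z
  proof -
    from box_basis[OF openin_interior_of that] obtain a b where ab: "in_box n a b z"
      "\<And>y. y \<in> pow_space n \<Longrightarrow> in_box n a b y \<Longrightarrow> y \<in> pow_top n interior_of (pow_top n closure_of X)"
      by metis
    have "\<forall>i<n. a i < b i" using ab(1) by (auto simp: in_box_def intro: less_trans)
    then obtain c d where cd: "subbox n a b c d" "\<forall>x\<in>X. \<not> in_box n c d x"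
      using Q by blast
    \<comment> \<open>Such a \<open>w\<close> lies in the closure of \<open>X\<close>, yet the box
      \<open>c\<close>, \<open>d\<close> is a neighbourhood of it that misses
      \<open>X\<close>.\<close>
    obtain w where w: "w \<in> pow_space n" "in_box n c d w"
      using box_nonempty[of n c d] cd(1) by (auto simp: subbox_def)
    then have "w \<in> pow_top n interior_of (pow_top n closure_of X)"
      by (intro ab(2) in_box_mono[OF cd(1)])
    then have "w \<in> pow_top n closure_of X"
      by (rule subsetD[OF interior_of_subset])
    then have "\<forall>T. w \<in> T \<and> openin (pow_top n) T \<longrightarrow> (\<exists>y. y \<in> X \<and> y \<in> T)"
      by (simp add: in_closure_of)
    from spec[OF this, of "{x \<in> pow_space n. in_box n c d x}"]
    obtain y where "y \<in> X" "y \<in> {x \<in> pow_space n. in_box n c d x}"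
      using openin_box[of n c d] w by auto
    then show False using cd(2) by simp
  qed
  then show "nowhere_dense_in n (pow_space n) X"
    using X by (auto simp: nowhere_dense_in_pow_space)
qed

section \<open>Sections of a definable family\<close>

lemma definable_pred_family:
  assumes "definable_family K N A" "simple_fun t" "\<And>i. simple_fun (\<lambda>E. g E i)"
  shows "definable_pred K (\<lambda>E. restrict (g E) {..<N} \<in> A (t E))"
proof -
  define X where "X = {join 1 (\<lambda>_. t) y | t y. y \<in> A t}"
  have X: "definable K (1 + N) X" and A: "\<And>t. A t \<subseteq> pow_space N"
    using assms(1) by (auto simp: definable_family_def X_def)
  define h where "h E i = (if i = 0 then t E else g E (i - 1))" for E i
  have "simple_fun (\<lambda>E. h E i)" for i
    using assms(2,3) by (cases "i = 0") (auto simp: h_def)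
  then have 1: "definable_pred K (\<lambda>E. restrict (h E) {..<1 + N} \<in> X)"
    by (rule definable_pred_mem[OF X])
  have 2: "restrict (h E) {..<1 + N} = join 1 (\<lambda>_. t E) (restrict (g E) {..<N})" for E
    by (auto simp: join_def h_def restrict_def fun_eq_iff)
  \<comment> \<open>A point of the total set determines both its index and its member, so membership
    in \<open>X\<close> gives back membership in \<open>A t\<close>.\<close>
  have 3: "join 1 (\<lambda>_. t) y \<in> X \<longleftrightarrow> y \<in> A t" for t y
  proof
    assume "join 1 (\<lambda>_. t) y \<in> X"
    then obtain t' y' where *: "join 1 (\<lambda>_. t) y = join 1 (\<lambda>_. t') y'" "y' \<in> A t'"
      by (auto simp: X_def)
    have "t = t'" using fun_cong[OF *(1), of 0] by (simp add: join_def)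
    moreover have "y i = y' i" for i using fun_cong[OF *(1), of "Suc i"] by (simp add: join_def)
    ultimately show "y \<in> A t" using *(2) by (metis ext)
  qed (auto simp: X_def)
  show ?thesis using 1 unfolding 2 3 .
qed

text \<open>In the total set, coordinate \<open>0\<close> is the index of the family and the shifted
  coordinates form the point.\<close>

lemma definable_familyI:
  assumes "definable_pred K (\<lambda>E. P (E 0 0) (\<lambda>i. E 0 (Suc i)))"
    and "\<And>t. A t = {x \<in> pow_space n. P t x}"
  shows "definable_family K n A"
proof -
  have "{join 1 (\<lambda>_. t) y | t y. y \<in> A t} = {u \<in> pow_space (1 + n). P (u 0) (\<lambda>i. u (Suc i))}"
    (is "?L = ?R")
  proof (intro equalityI subsetI)
    fix u assume "u \<in> ?L"
    then obtain t y where u: "u = join 1 (\<lambda>_. t) y" "y \<in> pow_space n" "P t y"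
      by (auto simp: assms(2))
    then show "u \<in> ?R" by (auto simp: join_def pow_space_def PiE_iff extensional_def)
  next
    fix u assume u: "u \<in> ?R"
    have "u = join 1 (\<lambda>_. u 0) (\<lambda>i. u (Suc i))"
      by (auto simp: join_def fun_eq_iff)
    moreover have "(\<lambda>i. u (Suc i)) \<in> A (u 0)"
      using u by (auto simp: assms(2) pow_space_def PiE_iff extensional_def)
    ultimately show "u \<in> ?L" by blast
  qed
  then show ?thesis
    using definable_Collect[OF assms(1), of "1 + n"] by (auto simp: definable_family_def assms(2))
qed

text \<open>\<open>simple_fun\<close> covers no arithmetic, so the inequalities with field
  operations that describe cubes are given by explicit formulas.\<close>

lemma definable_pred_mult_le [intro!]:
  assumes "simple_fun r" "simple_fun s" "simple_fun t"
  shows "definable_pred K (\<lambda>E. r E * s E \<le> r E * t E + 1)"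
proof -
  have "definable_pred K (\<lambda>E. r E * t E + 1 < r E * s E)"
    by (rule definable_predI[where
          p = "FLess (TAdd (TMul (TVar 0) (TVar 2)) TOne) (TMul (TVar 0) (TVar 1))"
          and g = "\<lambda>i. if i = 0 then r else if i = 1 then s else t"])
      (auto simp: assms)
  from definable_pred_not[OF this] show ?thesis by (simp add: not_less)
qed

lemma definable_pred_minus_le [intro!]:
  assumes "simple_fun s" "simple_fun t"
  shows "definable_pred K (\<lambda>E. - s E \<le> t E)"
proof -
  have "definable_pred K (\<lambda>E. t E < - s E)"
    by (rule definable_predI[where p = "FLess (TVar 1) (TNeg (TVar 0))"
          and g = "\<lambda>i. if i = 0 then s else t"])
      (auto simp: assms)
  from definable_pred_not[OF this] show ?thesis by (simp add: not_less)
qed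

text \<open>The section of \<open>A s\<close> at \<open>x\<close> is dense in the cube with lower corner \<open>l\<close> and side \<open>1 / s\<close>,
  written without division.\<close>

definition dense_in_cube ::
  "nat \<Rightarrow> nat \<Rightarrow> ('a::linordered_field \<Rightarrow> (nat \<Rightarrow> 'a) set) \<Rightarrow> 'a \<Rightarrow> (nat \<Rightarrow> 'a) \<Rightarrow> (nat \<Rightarrow> 'a) \<Rightarrow> bool"
  where "dense_in_cube m n A s x l \<longleftrightarrow>
    (\<forall>a b. (\<forall>i<n. l i \<le> a i \<and> a i < b i \<and> s * b i \<le> s * l i + 1) \<longrightarrow>
       (\<exists>w. in_box n a b w \<and> restrict (join m x w) {..<m + n} \<in> A s))"

text \<open>The projection of this relation to \<open>x\<close> is the set \<open>B s\<close>; the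
  bounds on \<open>l\<close> are those that the pigeonhole principle requires.\<close>

definition cube_pred ::
  "nat \<Rightarrow> nat \<Rightarrow> ('a::linordered_field \<Rightarrow> (nat \<Rightarrow> 'a) set) \<Rightarrow> 'a \<Rightarrow> (nat \<Rightarrow> 'a) \<Rightarrow> (nat \<Rightarrow> 'a) \<Rightarrow> bool"
  where "cube_pred m n A s x l \<longleftrightarrow>
    0 < s \<and> (\<forall>i<n. - s \<le> l i \<and> l i \<le> s) \<and> dense_in_cube m n A s x l"

lemma definable_pred_cube_pred:
  assumes "definable_family K (m + n) A" "simple_fun s"
    "\<And>i. simple_fun (\<lambda>E. x E i)" "\<And>i. simple_fun (\<lambda>E. l E i)"
  shows "definable_pred K (\<lambda>E. cube_pred m n A (s E) (x E) (l E))"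
proof -
  have j: "simple_fun (\<lambda>E. join m (E 4) (E 2) i)" for i
    by (cases "i < m") (auto simp: join_def)
  \<comment> \<open>Roles of the tuples: \<open>E 0\<close> and \<open>E 1\<close> are the corners
    \<open>a\<close> and \<open>b\<close>, \<open>E 2\<close> is \<open>w\<close>,
    \<open>E 3 0\<close> is \<open>s\<close>, \<open>E 4\<close> is \<open>x\<close> and
    \<open>E 5\<close> is \<open>l\<close>.\<close>
  have "definable_pred K (\<lambda>E. in_box n (E 0) (E 1) (E 2) \<and>
    restrict (join m (E 4) (E 2)) {..<m + n} \<in> A (E 3 0))"
    by (intro definable_pred_conj definable_pred_family[OF assms(1)] definable_pred_in_box j) auto
  from definable_pred_ex[OF this, of 2]
  have "definable_pred K (\<lambda>E. \<exists>w. in_box n (E 0) (E 1) w \<and>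
    restrict (join m (E 4) w) {..<m + n} \<in> A (E 3 0))" by simp
  then have "definable_pred K (\<lambda>E.
    (\<forall>i<n. E 5 i \<le> E 0 i \<and> E 0 i < E 1 i \<and> E 3 0 * E 1 i \<le> E 3 0 * E 5 i + 1) \<longrightarrow>
    (\<exists>w. in_box n (E 0) (E 1) w \<and> restrict (join m (E 4) w) {..<m + n} \<in> A (E 3 0)))" by auto
  from definable_pred_all[OF definable_pred_all[OF this, of 1], of 0]
  have "definable_pred K (\<lambda>E. dense_in_cube m n A (E 3 0) (E 4) (E 5))"
    by (simp add: dense_in_cube_def)
  then have "definable_pred K (\<lambda>E. cube_pred m n A (E 3 0) (E 4) (E 5))"
    unfolding cube_pred_def by auto
  moreover have "simple_fun (\<lambda>E. (if k = 3 then (\<lambda>_. s E) else if k = 4 then x E else l E) i)"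
    for k i :: nat
    using assms(2-4) by (cases "k = 3"; cases "k = 4") simp_all
  ultimately show ?thesis
    using definable_pred_subst[where g = "\<lambda>E k. if k = 3 then (\<lambda>_. s E) else if k = 4 then x E else l E"]
    by fastforce
qed

text \<open>As \<open>s\<close> grows, the cube shrinks and \<open>A s\<close> grows; both make
  density easier.\<close>

lemma dense_in_cube_mono:
  assumes "mono A" "0 < s" "s \<le> s'" "dense_in_cube m n A s x l"
  shows "dense_in_cube m n A s' x l"
  unfolding dense_in_cube_def
proof (intro allI impI)
  fix a b assume ab: "\<forall>i<n. l i \<le> a i \<and> a i < b i \<and> s' * b i \<le> s' * l i + 1"
  have "s * b i \<le> s * l i + 1" if "i < n" for i
  proof -
    have "l i \<le> b i" using ab that by (meson less_imp_le order_trans)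
    then have "s * (b i - l i) \<le> s' * (b i - l i)" using assms(3) by (intro mult_right_mono) auto
    also have "\<dots> \<le> 1" using ab that by (simp add: algebra_simps)
    finally show ?thesis by (simp add: algebra_simps)
  qed
  then have "\<exists>w. in_box n a b w \<and> restrict (join m x w) {..<m + n} \<in> A s"
    using ab assms(4) unfolding dense_in_cube_def by blast
  then show "\<exists>w. in_box n a b w \<and> restrict (join m x w) {..<m + n} \<in> A s'"
    using monoD[OF assms(1,3)] by blast
qed

lemma cube_pred_mono:
  assumes "mono A" "s \<le> s'" "cube_pred m n A s x l"
  shows "cube_pred m n A s' x l"
proof -
  have "- s' \<le> l i \<and> l i \<le> s'" if "i < n" for i
    using assms(2,3) that unfolding cube_pred_def by (meson neg_le_iff_le order_trans)
  then show ?thesis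
    using assms dense_in_cube_mono[OF assms(1) _ assms(2)] by (auto simp: cube_pred_def)
qed

text \<open>By contradiction: the pigeonhole principle is applied, for the fixed \<open>s\<close>,
  to the relation \<open>cube_pred m n A s\<close> between points and corners of cubes.\<close>

lemma nowhere_dense_cube_pred:
  fixes K :: "('a::{linordered_field, linorder_topology}, 'f, 'r) expansion"
  assumes K: "definably_complete K" and A: "definable_family K (m + n) A"
    and nd: "nowhere_dense_in (m + n) (pow_space (m + n)) (A s)"
  shows "nowhere_dense_in m (pow_space m) {x \<in> pow_space m. \<exists>l. cube_pred m n A s x l}"
  unfolding nowhere_dense_in_boxes
proof (intro conjI allI impI, blast, rule ccontr)
  fix p q :: "nat \<Rightarrow> 'a"
  assume pq: "\<forall>i<m. p i < q i"
    and neg: "\<not> (\<exists>a b. subbox m p q a b \<and>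
      (\<forall>x\<in>{x \<in> pow_space m. \<exists>l. cube_pred m n A s x l}. \<not> in_box m a b x))"
  have dense: "\<exists>x l. in_box m a b x \<and> cube_pred m n A s x l" if "subbox m p q a b" for a b
    using neg that by blast
  have "subbox m p q p q" using pq by (simp add: subbox_refl)
  with dense have s: "0 < s" unfolding cube_pred_def by blast
  \<comment> \<open>Corners \<open>l\<close> within \<open>\<delta>\<close> of \<open>c\<close>
    satisfy \<open>l i < c i + \<delta>\<close> and
    \<open>c i + 3 * \<delta> < l i + 4 * \<delta>\<close>. As \<open>4 * \<delta>\<close> is the
    side \<open>1 / s\<close>, the cube from \<open>c i + \<delta>\<close> to
    \<open>c i + 3 * \<delta>\<close> lies in all the cubes concerned.\<close>
  define \<delta> where "\<delta> = 1 / (4 * s)"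
  have \<delta>: "0 < \<delta>" "s * \<delta> * 4 = 1" using s by (auto simp: \<delta>_def)
  have G: "definable_pred K (\<lambda>E. cube_pred m n A s (E 0) (E 1))"
    by (rule definable_pred_cube_pred[OF A]) auto
  obtain c p' q' where c: "subbox m p q p' q'" "\<And>a b. subbox m p' q' a b \<Longrightarrow>
    \<exists>x l. in_box m a b x \<and> cube_pred m n A s x l \<and> in_box n (\<lambda>i. c i - \<delta>) (\<lambda>i. c i + \<delta>) l"
    using pigeonhole[OF K G _ pq dense \<delta>(1), of n s] unfolding cube_pred_def by blast
  define a0 where "a0 = join m p' (\<lambda>i. c i + \<delta>)"
  define b0 where "b0 = join m q' (\<lambda>i. c i + 3 * \<delta>)"
  have "a0 i < b0 i" if "i < m + n" for i
    using c(1) that \<delta>(1) by (auto simp: a0_def b0_def join_def subbox_def)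
  \<comment> \<open>The box missing \<open>A s\<close> is fixed first; \<open>x\<close> and
    \<open>l\<close> are chosen afterwards, with \<open>x\<close> in its projection to the first
    \<open>m\<close> coordinates.\<close>
  then obtain a b where ab: "subbox (m + n) a0 b0 a b" "\<forall>y\<in>A s. \<not> in_box (m + n) a b y"
    using nd unfolding nowhere_dense_in_boxes by meson
  have ab1: "subbox m p' q' a b"
    unfolding subbox_def
  proof (intro allI impI)
    fix i assume "i < m"
    then show "p' i \<le> a i \<and> a i < b i \<and> b i \<le> q' i"
      using ab(1)[unfolded subbox_def, rule_format, of i] by (simp add: a0_def b0_def join_def)
  qed
  let ?a = "\<lambda>i. a (m + i)" and ?b = "\<lambda>i. b (m + i)"
  have ab2: "c i + \<delta> \<le> ?a i" "?a i < ?b i" "?b i \<le> c i + 3 * \<delta>" if "i < n" for i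
    using ab(1)[unfolded subbox_def, rule_format, of "m + i"] that
    by (auto simp: a0_def b0_def join_def)
  obtain x l where xl: "in_box m a b x" "cube_pred m n A s x l"
      "in_box n (\<lambda>i. c i - \<delta>) (\<lambda>i. c i + \<delta>) l"
    using c(2)[OF ab1] by blast
  have cube: "l i \<le> ?a i \<and> ?a i < ?b i \<and> s * ?b i \<le> s * l i + 1" if "i < n" for i
  proof -
    have l: "c i - \<delta> < l i" "l i < c i + \<delta>" using xl(3) that by (auto simp: in_box_def)
    have "?b i \<le> l i + 4 * \<delta>" using l ab2[OF that] by linarith
    then have "s * ?b i \<le> s * (l i + 4 * \<delta>)" using s by (intro mult_left_mono) auto
    also have "\<dots> = s * l i + 1" using \<delta>(2) by (simp add: algebra_simps)
    finally show ?thesis using l ab2[OF that] by linarith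
  qed
  have "dense_in_cube m n A s x l" using xl(2) by (simp add: cube_pred_def)
  from this[unfolded dense_in_cube_def, rule_format, of ?a ?b, OF cube]
  obtain w where w: "in_box n ?a ?b w" "restrict (join m x w) {..<m + n} \<in> A s"
    by blast
  have "in_box (m + n) a b (restrict (join m x w) {..<m + n})"
    unfolding in_box_def
  proof (intro allI impI)
    fix i assume i: "i < m + n"
    show "a i < restrict (join m x w) {..<m + n} i \<and> restrict (join m x w) {..<m + n} i < b i"
    proof (cases "i < m")
      case True
      then show ?thesis using xl(1) by (auto simp: in_box_def join_def)
    next
      case False
      then show ?thesis
        using w(1)[unfolded in_box_def, rule_format, of "i - m"] i by (auto simp: join_def)
    qed
  qed
  then show False using ab(2) w(2) by blast
qed

text \<open>The sections of the sets \<open>A t\<close> at \<open>x\<close> are the witnessing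
  family: one that is dense in some box would be dense in a cube for large \<open>s\<close>.\<close>

lemma definably_meager_section:
  fixes K :: "('a::{linordered_field, linorder_topology}, 'f, 'r) expansion"
  assumes A: "definable_family K (m + n) A" "mono A" and D: "D \<subseteq> (\<Union>t. A t)"
    and x: "x \<in> pow_space m" and no_cube: "\<And>s l. \<not> cube_pred m n A s x l"
  shows "definably_meager K n (pow_space n) (section_at m n D x)"
  unfolding definably_meager_def
proof (intro conjI exI allI)
  let ?F = "\<lambda>t. section_at m n (A t) x"
  \<comment> \<open>Here \<open>y\<close> is already \<open>undefined\<close> from \<open>n\<close>
    onwards, so the restriction in \<open>dense_in_cube\<close> changes nothing.\<close>
  have join: "restrict (join m x y) {..<m + n} = join m x y" if "y \<in> pow_space n" for y
    using that by (intro ext) (auto simp: join_def pow_space_def PiE_iff extensional_def)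
  show "definable K n (pow_space n)" by (rule definable_pow_space)
  show "section_at m n D x \<subseteq> pow_space n" by (auto simp: section_at_def)
  show "section_at m n D x \<subseteq> (\<Union>t. ?F t)" using D by (auto simp: section_at_def)
  show "mono ?F" using A(2) by (fastforce simp: section_at_def mono_def)
  have "simple_fun (\<lambda>E. join m x (\<lambda>i. E 0 (Suc i)) i)" for i
    by (cases "i < m") (auto simp: join_def)
  then have "definable_pred K (\<lambda>E. restrict (join m x (\<lambda>i. E 0 (Suc i))) {..<m + n} \<in> A (E 0 0))"
    by (intro definable_pred_family[OF A(1)]) auto
  then show "definable_family K n ?F"
    by (rule definable_familyI[where P = "\<lambda>t y. restrict (join m x y) {..<m + n} \<in> A t"])
      (auto simp: section_at_def join)
  fix t
  show "nowhere_dense_in n (pow_space n) (?F t)"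
    unfolding nowhere_dense_in_boxes
  proof (intro conjI allI impI, force simp: section_at_def, rule ccontr)
    fix a b :: "nat \<Rightarrow> 'a"
    assume ab: "\<forall>i<n. a i < b i"
      and neg: "\<not> (\<exists>a' b'. subbox n a b a' b' \<and> (\<forall>x\<in>?F t. \<not> in_box n a' b' x))"
    \<comment> \<open>So large that \<open>A s\<close> contains \<open>A t\<close>, that the corner
      \<open>a\<close> is within the bounds, and that the cube of side \<open>1 / s\<close> at
      \<open>a\<close> fits into the box; the entry \<open>1\<close> makes \<open>s\<close>
      positive.\<close>
    define s where "s = Max (insert t (insert 1 ((\<lambda>i. \<bar>a i\<bar>) ` {..<n} \<union> (\<lambda>i. 1 / (b i - a i)) ` {..<n})))"
    have s: "t \<le> s" "1 \<le> s" unfolding s_def by - (rule Max_ge; simp)+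
    have s': "\<bar>a i\<bar> \<le> s" "1 / (b i - a i) \<le> s" if "i < n" for i
      using that unfolding s_def by - (rule Max_ge; force)+
    have "dense_in_cube m n A s x a"
      unfolding dense_in_cube_def
    proof (intro allI impI)
      fix a' b' assume a': "\<forall>i<n. a i \<le> a' i \<and> a' i < b' i \<and> s * b' i \<le> s * a i + 1"
      have "b' i \<le> b i" if "i < n" for i
      proof -
        have "1 \<le> s * (b i - a i)" using s'(2)[OF that] ab that by (simp add: divide_le_eq)
        moreover have "s * (b' i - a i) \<le> 1" using a' that by (simp add: algebra_simps)
        ultimately have "s * (b' i - a i) \<le> s * (b i - a i)" by linarith
        then have "b' i - a i \<le> b i - a i" using s(2) by (subst (asm) mult_le_cancel_left_pos) auto
        then show ?thesis by simp
      qed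
      then have "subbox n a b a' b'" using a' by (auto simp: subbox_def)
      then obtain y where "y \<in> ?F t" "in_box n a' b' y" using neg by blast
      moreover have "A t \<subseteq> A s" using A(2) s(1) by (rule monoD)
      ultimately show "\<exists>w. in_box n a' b' w \<and> restrict (join m x w) {..<m + n} \<in> A s"
        by (auto simp: section_at_def join intro!: exI[of _ y])
    qed
    moreover have "- s \<le> a i \<and> a i \<le> s" if "i < n" for i
      using s'(1)[OF that] by (simp add: abs_le_iff)
    ultimately show False
      using no_cube[of s a] s(2) by (simp add: cube_pred_def)
  qed
qed

theorem theorem4p1:
  fixes K :: "('a::{linordered_field, linorder_topology}, 'f, 'r) expansion"
    and m n :: nat
    and D :: "(nat \<Rightarrow> 'a) set"
  assumes "definably_complete K"
    and "1 \<le> m"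
    and "1 \<le> n"
    and "D \<subseteq> pow_space (m + n)"
    and "definably_meager K (m + n) (pow_space (m + n)) D"
  shows "definably_residual K m (pow_space m)
    {x \<in> pow_space m. definably_meager K n (pow_space n) (section_at m n D x)}"
proof -
  obtain A where A: "definable_family K (m + n) A" "mono A" "D \<subseteq> (\<Union>t. A t)"
    and nd: "\<And>t. nowhere_dense_in (m + n) (pow_space (m + n)) (A t)"
    using assms(5) unfolding definably_meager_def by blast
  define B where "B s = {x \<in> pow_space m. \<exists>l. cube_pred m n A s x l}" for s
  \<comment> \<open>Tuple \<open>0\<close> holds \<open>s\<close> followed by \<open>x\<close>;
    tuple \<open>1\<close> holds \<open>l\<close>, which is then projected away.\<close>
  have "definable_pred K (\<lambda>E. cube_pred m n A (E 0 0) (\<lambda>i. E 0 (Suc i)) (E 1))"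
    by (rule definable_pred_cube_pred[OF A(1)]) auto
  from definable_pred_ex[OF this, of 1]
  have "definable_family K m B"
    by (intro definable_familyI[where P = "\<lambda>s x. \<exists>l. cube_pred m n A s x l"]) (auto simp: B_def)
  moreover have "nowhere_dense_in m (pow_space m) (B s)" for s
    unfolding B_def by (rule nowhere_dense_cube_pred[OF assms(1) A(1) nd])
  moreover have "mono B"
    using cube_pred_mono[OF A(2)] by (fastforce simp: B_def mono_def)
  moreover have "pow_space m -
      {x \<in> pow_space m. definably_meager K n (pow_space n) (section_at m n D x)} \<subseteq> (\<Union>s. B s)"
    using definably_meager_section[OF A] by (auto simp: B_def)
  ultimately show ?thesis
    unfolding definably_residual_def definably_meager_def
    by (intro conjI exI[of _ B] definable_pow_space allI) auto
qed

end
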